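(* Let $\widehat{A}=A+\epsilon B\in\mathbb{DR}^{n\times n}$ with $\operatorname{Ind}(A)=m$. If the dual core-EP generalized inverse of $\widehat{A}$ exists, then it is unique; that is, there is at most one $\widehat{X}\in\mathbb{DR}^{n\times n}$ satisfying $(\widehat{A}\widehat{X})^{T}=\widehat{A}\widehat{X}$, $\widehat{A}\widehat{X}^{2}=\widehat{X}$ and $\widehat{X}\widehat{A}^{m+1}=\widehat{A}^{m}$.
   Context: Dual numbers are $a+\epsilon b$ with $a,b\in\mathbb{R}$, $\epsilon\neq 0$, $\epsilon^2=0$. $\mathbb{DR}^{n\times n}$ denotes the set of $n\times n$ dual real matrices $\widehat{A}=A+\epsilon B$ with $A,B\in\mathbb{R}^{n\times n}$ ($A$ is the standard part, $B$ the infinitesimal part), with product $(A+\epsilon B)(C+\epsilon D)=AC+\epsilon(AD+BC)$ and transpose $(A+\epsilon B)^T=A^T+\epsilon B^T$. For a real square matrix $A$, $\operatorname{Ind}(A)$ is the smallest nonnegative integer $s$ with $\operatorname{rank}(A^{s+1})=\operatorname{rank}(A^s)$. For $\widehat{A}=A+\epsilon B$ with $\operatorname{Ind}(A)=m$, a matrix $\widehat{X}\in\mathbb{DR}^{n\times n}$ is called a dual core-EP generalized inverse of $\widehat{A}$ if $(\widehat{A}\widehat{X})^{T}=\widehat{A}\widehat{X}$, $\widehat{A}\widehat{X}^{2}=\widehat{X}$, $\widehat{X}\widehat{A}^{m+1}=\widehat{A}^{m}$. *)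

theory Defs
  imports "HOL-Analysis.Analysis"
begin

text \<open>
  \<open>Dual a b\<close> is the dual number \<open>a + \<epsilon> b\<close> with \<open>\<epsilon> \<noteq> 0\<close> and \<open>\<epsilon>\<^sup>2 = 0\<close>.
\<close>

datatype dual = Dual (std_part: real) (inf_part: real)

lemma dual_eq_iff: "x = y \<longleftrightarrow> std_part x = std_part y \<and> inf_part x = inf_part y"
  by (cases x; cases y) simp

instantiation dual :: comm_ring_1
begin

definition "0 = Dual 0 0"
definition "1 = Dual 1 0"
definition "x + y = Dual (std_part x + std_part y) (inf_part x + inf_part y)"
definition "x - y = Dual (std_part x - std_part y) (inf_part x - inf_part y)"
definition "- x = Dual (- std_part x) (- inf_part x)"
definition "x * y = Dual (std_part x * std_part y)
                         (std_part x * inf_part y + inf_part x * std_part y)"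

instance
  by standard
     (simp_all add: dual_eq_iff zero_dual_def one_dual_def plus_dual_def minus_dual_def
        uminus_dual_def times_dual_def algebra_simps)

end

definition eps :: dual where
  "eps = Dual 0 1"

lemma eps_neq_0: "eps \<noteq> 0"
  by (simp add: eps_def zero_dual_def)

lemma eps_squared: "eps\<^sup>2 = 0"
  by (simp add: eps_def zero_dual_def times_dual_def power2_eq_square)

lemma Dual_eq: "Dual a b = Dual a 0 + eps * Dual b 0"
  by (simp add: eps_def plus_dual_def times_dual_def)

text \<open>
  \<open>dual_matrix A B\<close> is \<open>A + \<epsilon> B\<close>; sums, products and transposes of dual matrices are
  the library operations at entry type \<^typ>\<open>dual\<close>.
\<close>

definition dual_matrix :: "real^'n^'m \<Rightarrow> real^'n^'m \<Rightarrow> dual^'n^'m" where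
  "dual_matrix A B = (\<chi> i j. Dual (A $ i $ j) (B $ i $ j))"

definition std_matrix :: "dual^'n^'m \<Rightarrow> real^'n^'m" where
  "std_matrix X = (\<chi> i j. std_part (X $ i $ j))"

definition inf_matrix :: "dual^'n^'m \<Rightarrow> real^'n^'m" where
  "inf_matrix X = (\<chi> i j. inf_part (X $ i $ j))"

lemma std_matrix_dual_matrix [simp]: "std_matrix (dual_matrix A B) = A"
  by (simp add: std_matrix_def dual_matrix_def vec_eq_iff)

lemma inf_matrix_dual_matrix [simp]: "inf_matrix (dual_matrix A B) = B"
  by (simp add: inf_matrix_def dual_matrix_def vec_eq_iff)

lemma dual_matrix_collapse [simp]: "dual_matrix (std_matrix X) (inf_matrix X) = X"
  by (simp add: std_matrix_def inf_matrix_def dual_matrix_def vec_eq_iff)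

lemma sum_Dual: "(\<Sum>k\<in>S. Dual (f k) (g k)) = Dual (\<Sum>k\<in>S. f k) (\<Sum>k\<in>S. g k)"
  by (induction S rule: infinite_finite_induct) (simp_all add: zero_dual_def plus_dual_def)

lemma dual_matrix_mult:
  "dual_matrix A B ** dual_matrix C D = dual_matrix (A ** C) (A ** D + B ** C)"
  by (simp add: dual_matrix_def matrix_matrix_mult_def vec_eq_iff times_dual_def sum_Dual
      sum.distrib)

lemma transpose_dual_matrix:
  "transpose (dual_matrix A B) = dual_matrix (transpose A) (transpose B)"
  by (simp add: dual_matrix_def transpose_def vec_eq_iff)

text \<open>
  The operation \<open>^\<close> on \<open>'a^'n^'n\<close> is the componentwise power, so powers with respect
  to \<open>**\<close> need a separate definition.
\<close>

primrec mpow :: "'a::semiring_1^'n^'n \<Rightarrow> nat \<Rightarrow> 'a^'n^'n" where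
  "mpow A 0 = mat 1"
| "mpow A (Suc k) = A ** mpow A k"

definition mat_index :: "real^'n^'n \<Rightarrow> nat" where
  "mat_index A = (LEAST s. rank (mpow A (s + 1)) = rank (mpow A s))"

lemma mat_index: "rank (mpow A (mat_index A + 1)) = rank (mpow A (mat_index A))"
proof -
  have "\<exists>s. rank (mpow A (s + 1)) = rank (mpow A s)"
  proof (rule ccontr)
    assume neq: "\<not> ?thesis"
    have less: "rank (mpow A (Suc s)) < rank (mpow A s)" for s
      using neq rank_mul_le_right[of A "mpow A s"] by (simp add: le_less)
    have "rank (mpow A s) + s \<le> rank (mpow A 0)" for s
    proof (induction s)
      case (Suc s)
      then show ?case
        using less[of s] by linarith
    qed simp
    from this[of "Suc (rank (mpow A 0))"] show False
      by simp
  qed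
  then show ?thesis
    unfolding mat_index_def by (rule LeastI_ex)
qed

text \<open>The index in the third equation is that of the standard part.\<close>

definition is_dual_core_EP_inverse :: "dual^'n^'n \<Rightarrow> dual^'n^'n \<Rightarrow> bool" where
  "is_dual_core_EP_inverse A X \<longleftrightarrow>
     (let m = mat_index (std_matrix A) in
       transpose (A ** X) = A ** X \<and>
       A ** mpow X 2 = X \<and>
       X ** mpow A (m + 1) = mpow A m)"

end

theory Submission
  imports Defs
begin

text \<open>
  Square matrices over a commutative ring, such as the dual numbers, form a ring in which
  transposition reverses products, and uniqueness is a computation in that ring.

  Let \<open>X\<close> and \<open>Y\<close> both satisfy the three equations. Iterating \<open>A Y\<^sup>2 = Y\<close> gives
  \<open>A\<^sup>m Y\<^sup>m\<^sup>+\<^sup>1 = Y\<close>, so \<open>A Y = A\<^sup>m\<^sup>+\<^sup>1 Y\<^sup>m\<^sup>+\<^sup>1\<close>, and \<open>X A\<^sup>m\<^sup>+\<^sup>1 = A\<^sup>m\<close> lets \<open>X\<close> cancel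
  the extra factor \<open>A\<close>: \<open>X A Y = Y\<close> (lemma \<open>left_cancel_on_powers\<close>). The lemma relates the third
  equation for one matrix to the second equation for another, so it applies to all four pairs
  formed from \<open>X\<close> and \<open>Y\<close>. Hence \<open>(A X)(A Y) = A Y\<close> and \<open>(A Y)(A X) = A X\<close>: the idempotents
  \<open>A X\<close> and \<open>A Y\<close> have the same range. Both are symmetric, so transposing the first identity gives
  \<open>A X = A Y\<close>, just as an orthogonal projector is determined by its range. Finally
  \<open>X = X (A X) = X (A Y) = Y\<close>.
\<close>

lemma mpow_Suc_right: "mpow A (Suc k) = mpow A k ** A"
  by (induction k) (simp_all add: matrix_mul_assoc)

lemma mpow_two: "mpow A 2 = A ** A"
  by (simp add: numeral_2_eq_2)

text \<open>
  The equation says that one factor \<open>A\<close> on the left undoes one of two factors \<open>Y\<close>; the same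
  cancellation can be repeated \<open>k\<close> times, from the middle of the product outwards.
\<close>

lemma mpow_mult_mpow_Suc:
  assumes "A ** mpow Y 2 = Y"
  shows "mpow A k ** mpow Y (Suc k) = Y"
proof (induction k)
  case (Suc k)
  have "mpow A (Suc k) ** mpow Y (Suc (Suc k)) = A ** (mpow A k ** mpow Y (Suc k)) ** Y"
    unfolding mpow_Suc_right[of Y "Suc k"] by (simp add: matrix_mul_assoc)
  also have "\<dots> = A ** mpow Y 2"
    by (simp only: Suc mpow_two matrix_mul_assoc)
  finally show ?case
    using assms by simp
qed simp

text \<open>
  \<open>X\<close> is a left inverse of \<open>A\<close> on the column space of \<open>A\<^sup>m\<close>. The second equation places
  the columns of \<open>Y\<close> there, because \<open>Y = A\<^sup>m Y\<^sup>m\<^sup>+\<^sup>1\<close>.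
\<close>

lemma left_cancel_on_powers:
  assumes "X ** mpow A (Suc m) = mpow A m"
    and "A ** mpow Y 2 = Y"
  shows "X ** (A ** Y) = Y"
proof -
  have Y: "mpow A m ** mpow Y (Suc m) = Y"
    using assms(2) by (rule mpow_mult_mpow_Suc)
  have "X ** (A ** Y) = X ** (A ** (mpow A m ** mpow Y (Suc m)))"
    by (simp only: Y)
  also have "\<dots> = X ** mpow A (Suc m) ** mpow Y (Suc m)"
    by (simp add: matrix_mul_assoc)
  also have "\<dots> = Y"
    by (simp only: assms(1) Y)
  finally show ?thesis .
qed

text \<open>
  \<open>A X\<close> and \<open>A Y\<close> are symmetric idempotents that fix each other under left multiplication, and
  transposing \<open>(A X)(A Y) = A Y\<close> gives \<open>(A Y)(A X) = A Y\<close>, whose left side is also \<open>A X\<close>. So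
  they coincide, and \<open>X\<close> and \<open>Y\<close> are both the product of \<open>X\<close> with this common projector.
\<close>

lemma core_EP_equations_unique:
  fixes A X Y :: "'a::comm_semiring_1^'n^'n"
  assumes X: "transpose (A ** X) = A ** X" "A ** mpow X 2 = X"
      "X ** mpow A (Suc m) = mpow A m"
    and Y: "transpose (A ** Y) = A ** Y" "A ** mpow Y 2 = Y"
      "Y ** mpow A (Suc m) = mpow A m"
  shows "X = Y"
proof -
  have XAY: "X ** (A ** Y) = Y"
    by (rule left_cancel_on_powers[OF X(3) Y(2)])
  have YAX: "Y ** (A ** X) = X"
    by (rule left_cancel_on_powers[OF Y(3) X(2)])
  have XAX: "X ** (A ** X) = X"
    by (rule left_cancel_on_powers[OF X(3) X(2)])
  have "A ** Y = transpose ((A ** X) ** (A ** Y))"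
    by (simp only: XAY Y(1) matrix_mul_assoc[symmetric])
  also have "\<dots> = (A ** Y) ** (A ** X)"
    by (simp only: matrix_transpose_mul[of "A ** X"] X(1) Y(1))
  also have "\<dots> = A ** X"
    by (simp only: YAX matrix_mul_assoc[symmetric])
  finally have "A ** X = A ** Y"
    by (rule sym)
  with XAX XAY show ?thesis
    by metis
qed

theorem theorem3p2:
  fixes A B :: "real^'n^'n" and A' :: "dual^'n^'n" and m :: nat
  assumes "A' = dual_matrix A B"
    and "mat_index A = m"
  shows "((\<exists>X. is_dual_core_EP_inverse A' X) \<longrightarrow> (\<exists>!X. is_dual_core_EP_inverse A' X)) \<and>
    (\<exists>\<^sub>\<le>\<^sub>1 X :: dual^'n^'n.
        transpose (A' ** X) = A' ** X \<and>
        A' ** mpow X 2 = X \<and>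
        X ** mpow A' (m + 1) = mpow A' m)"
proof -
  let ?eqs = "\<lambda>X. transpose (A' ** X) = A' ** X \<and> A' ** mpow X 2 = X \<and>
    X ** mpow A' (m + 1) = mpow A' m"
  have unique: "X = Y" if "?eqs X" "?eqs Y" for X Y
    using core_EP_equations_unique[of A' X m Y] that unfolding Suc_eq_plus1 by blast
  have "is_dual_core_EP_inverse A' X \<longleftrightarrow> ?eqs X" for X
    by (simp only: is_dual_core_EP_inverse_def Let_def assms std_matrix_dual_matrix)
  then show ?thesis
    using unique unfolding Uniq_def by blast
qed

end
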